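(* Let $n\ge 1$ and let $X_1,\dots,X_n$ be independent integer-valued random variables. Then $$\Delta_\infty(X_1+\cdots+X_n)\ \geq\ \frac{1}{22}\sum_{i=1}^n\Delta_\infty(X_i).$$
   Context: For an integer-valued random variable $X$ with $f_X(k)=\mathbb{P}(X=k)$, let $\|f_X\|_\infty=\sup_{k\in\mathbb{Z}}f_X(k)$, $H_\infty(X)=-\log\|f_X\|_\infty$ (natural logarithm), and $\Delta_\infty(X)=e^{2H_\infty(X)}-1=\|f_X\|_\infty^{-2}-1$. *)

theory Defs
  imports "HOL-Probability.Probability"
begin

definition prob_mass :: "'a measure \<Rightarrow> ('a \<Rightarrow> int) \<Rightarrow> int \<Rightarrow> real"
  where "prob_mass M X k = measure M {\<omega> \<in> space M. X \<omega> = k}"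

definition mass_sup :: "'a measure \<Rightarrow> ('a \<Rightarrow> int) \<Rightarrow> real"
  where "mass_sup M X = (SUP k. prob_mass M X k)"

definition min_entropy :: "'a measure \<Rightarrow> ('a \<Rightarrow> int) \<Rightarrow> real"
  where "min_entropy M X = - ln (mass_sup M X)"

text \<open>On a probability space the masses lie in $[0,1]$ and sum to $1$ for an integer-valued
  random variable, so the supremum is positive and this equals \<open>1 / (mass_sup M X)^2 - 1\<close>.\<close>

definition Delta_inf :: "'a measure \<Rightarrow> ('a \<Rightarrow> int) \<Rightarrow> real"
  where "Delta_inf M X = exp (2 * min_entropy M X) - 1"

end

theory Submission
  imports Defs
begin

text \<open>Let $Q_k(m)$ be the largest probability that $X_1+\dots+X_k$ lies in an $m$-element set of
  integers, extended to an odd function of $m$. A law whose masses are at most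
  $\mu = (1-\theta)/l + \theta/(l+1)$ can be replaced by a mixture of uniform laws on $l$ and on $l+1$
  points. Splitting a grid $A \times B$ into hooks on which $b - a$ is injective shows that, when
  a uniform law on $l$ points is added, the new $Q$ is at most the average of the old one over the
  offsets $l-1, l-3, \dots, -(l-1)$ of its argument. Hence $Q_n(1)$ is at most a mixture of quantities obtained by
  averaging the sign function over such offsets. Each of them is the central mass of a symmetric
  log-concave law on the integers, with variance at least $\sum (l_i^2-1)/12$, and for such a law
  the central mass $M$ satisfies $1 + 2\sigma^2 \le M^{-2}$, because its tails decay at least as fast
  as those of the two-sided geometric law with the same central mass. The mixture over the $l_i$ is
  removed by concavity of the square root, one variable at a time.\<close>

section \<open>Averaging over symmetric offsets\<close>

text \<open>Convolution with the uniform law on \<open>l\<close> points centred at 0 and stretched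
  by 2; the stretch keeps the offsets integral when \<open>l\<close> is even.\<close>

definition smooth :: "nat \<Rightarrow> (int \<Rightarrow> real) \<Rightarrow> int \<Rightarrow> real"
  where "smooth l F m = (\<Sum>j<l. F (m + int l - 1 - 2 * int j)) / real l"

lemma smooth_uminus:
  assumes odd: "\<And>m. F (- m) = - F m"
  shows "smooth l F (- m) = - smooth l F m"
proof -
  have "(\<Sum>j<l. F (- m + int l - 1 - 2 * int j)) =
        (\<Sum>j<l. F (- m + int l - 1 - 2 * int (l - Suc j)))"
    by (rule sum.nat_diff_reindex [symmetric])
  also have "\<dots> = (\<Sum>j<l. - F (m + int l - 1 - 2 * int j))"
  proof (rule sum.cong [OF refl])
    fix j assume "j \<in> {..<l}"
    then have "- m + int l - 1 - 2 * int (l - Suc j) = - (m + int l - 1 - 2 * int j)"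
      by (auto simp: of_nat_diff)
    then show "F (- m + int l - 1 - 2 * int (l - Suc j)) = - F (m + int l - 1 - 2 * int j)"
      by (simp only: odd)
  qed
  finally show ?thesis by (simp add: smooth_def sum_negf)
qed

lemma smooth_linear:
  "smooth l (\<lambda>m. a * F m + b * G m) = (\<lambda>m. a * smooth l F m + b * smooth l G m)"
  by (rule ext) (simp add: smooth_def sum.distrib sum_distrib_left add_divide_distrib)

lemma smooth_shift: "smooth l (\<lambda>m. F (m + c)) = (\<lambda>m. smooth l F (m + c))"
  by (rule ext) (simp add: smooth_def algebra_simps)

text \<open>For \<open>m < l\<close> the offsets that make the argument non-positive cancel in pairs.\<close>

lemma smooth_hooks:
  assumes odd: "\<And>m. F (- m) = - F m"
  shows "smooth l F (int m) = (\<Sum>t<min l m. F (int (l + m - 1 - 2 * t))) / real l"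
proof -
  have "(\<Sum>j<l. F (int m + int l - 1 - 2 * int j)) = (\<Sum>j<min l m. F (int m + int l - 1 - 2 * int j))"
  proof (cases "l \<le> m")
    case False
    define r where "r = (\<Sum>j=m..<l. F (int m + int l - 1 - 2 * int j))"
    have "r = (\<Sum>j=m..<l. F (int m + int l - 1 - 2 * int (m + l - Suc j)))"
      unfolding r_def
      by (rule sum.reindex_bij_witness [where i = "\<lambda>j. m + l - Suc j" and j = "\<lambda>j. m + l - Suc j"]) auto
    also have "\<dots> = (\<Sum>j=m..<l. - F (int m + int l - 1 - 2 * int j))"
    proof (rule sum.cong [OF refl])
      fix j assume "j \<in> {m..<l}"
      then have "int m + int l - 1 - 2 * int (m + l - Suc j) = - (int m + int l - 1 - 2 * int j)"
        by (auto simp: of_nat_diff)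
      then show "F (int m + int l - 1 - 2 * int (m + l - Suc j)) = - F (int m + int l - 1 - 2 * int j)"
        by (simp only: odd)
    qed
    also have "\<dots> = - r" by (simp add: r_def sum_negf)
    finally have "r = 0" by simp
    moreover have "{..<l} = {..<m} \<union> {m..<l}" using False by auto
    ultimately show ?thesis using False
      by (simp add: r_def sum.union_disjoint ivl_disj_int min_def)
  qed (simp add: min_def)
  also have "\<dots> = (\<Sum>t<min l m. F (int (l + m - 1 - 2 * t)))"
    by (rule sum.cong [OF refl], rule arg_cong [where f = F]) (auto simp: of_nat_diff)
  finally show ?thesis by (simp add: smooth_def)
qed

section \<open>Grids of differences and the bathtub principle\<close>

text \<open>The hook through \<open>Max A\<close> and \<open>Max B\<close> has \<open>card A + card B - 1\<close> distinct differences; removing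
  it leaves a smaller grid.\<close>

lemma sum_differences_le_hooks:
  fixes A B :: "int set" and g Q :: "_ \<Rightarrow> real"
  assumes Q: "\<And>C. finite C \<Longrightarrow> sum g C \<le> Q (card C)"
    and "finite A" "finite B" "card A = l" "card B = m"
  shows "(\<Sum>a\<in>A. \<Sum>b\<in>B. g (b - a)) \<le> (\<Sum>t<min l m. Q (l + m - 1 - 2 * t))"
  using assms(2-)
proof (induction l arbitrary: m A B)
  case 0
  then show ?case by simp
next
  case (Suc l)
  show ?case
  proof (cases m)
    case 0
    then show ?thesis using Suc.prems by simp
  next
    case (Suc m')
    define x y where "x = Max A" and "y = Max B"
    have ne: "A \<noteq> {}" "B \<noteq> {}" using Suc.prems Suc by auto
    have x: "x \<in> A" "\<And>a. a \<in> A \<Longrightarrow> a \<le> x" and y: "y \<in> B" "\<And>b. b \<in> B \<Longrightarrow> b \<le> y"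
      using ne Suc.prems by (auto simp: x_def y_def)
    define A' B' where "A' = A - {x}" and "B' = B - {y}"
    have A: "A = insert x A'" "x \<notin> A'" "finite A'" "card A' = l"
      and B: "B = insert y B'" "y \<notin> B'" "finite B'" "card B' = m'"
      using Suc.prems x y Suc by (auto simp: A'_def B'_def)
    define H where "H = (\<lambda>b. b - x) ` B \<union> (\<lambda>a. y - a) ` A'"
    \<comment> \<open>Every \<open>b - x\<close> is at most \<open>y - x\<close>, while every
      \<open>y - a\<close> with \<open>a < x\<close> exceeds it.\<close>
    have disj: "(\<lambda>b. b - x) ` B \<inter> (\<lambda>a. y - a) ` A' = {}"
    proof -
      have "b - x \<noteq> y - a" if "b \<in> B" "a \<in> A'" for a b
      proof -
        have "a < x" using x(2)[of a] that A(1,2) by (metis insertCI order_less_le)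
        then show ?thesis using y(2)[OF that(1)] by linarith
      qed
      then show ?thesis by auto
    qed
    have inj: "inj_on (\<lambda>b. b - x) B" "inj_on (\<lambda>a. y - a) A'" by (auto simp: inj_on_def)
    have fin: "finite ((\<lambda>b. b - x) ` B)" "finite ((\<lambda>a. y - a) ` A')"
      using A(3) Suc.prems(2) by blast+
    have cH: "card H = l + Suc m'"
      unfolding H_def card_Un_disjoint [OF fin disj] card_image [OF inj(1)] card_image [OF inj(2)]
      using A(4) Suc.prems(4) Suc by simp
    have sH: "sum g H = (\<Sum>b\<in>B. g (b - x)) + (\<Sum>a\<in>A'. g (y - a))"
      unfolding H_def sum.union_disjoint [OF fin disj] by (simp add: sum.reindex [OF inj(1)] sum.reindex [OF inj(2)])
    have "(\<Sum>a\<in>A. \<Sum>b\<in>B. g (b - a)) = sum g H + (\<Sum>a\<in>A'. \<Sum>b\<in>B'. g (b - a))"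
      unfolding sH using A B by (simp add: sum.distrib)
    also have "\<dots> \<le> Q (l + Suc m') + (\<Sum>t<min l m'. Q (l + m' - 1 - 2 * t))"
      using Q[of H] cH fin by (intro add_mono Suc.IH[OF A(3) B(3) A(4) B(4)]) (simp add: H_def)
    \<comment> \<open>Both side lengths drop by one, so hook \<open>t\<close> of the smaller grid is
      hook \<open>t + 1\<close> of the original grid.\<close>
    also have "\<dots> = (\<Sum>t<min (Suc l) m. Q (Suc l + m - 1 - 2 * t))"
      using Suc by (simp add: sum.lessThan_Suc_shift del: sum.lessThan_Suc)
    finally show ?thesis .
  qed
qed

text \<open>Built greedily: each step adds a maximiser of \<open>w\<close> among the points that are
  left.\<close>

lemma obtain_top_subset:
  fixes w :: "'b \<Rightarrow> real"
  assumes "finite C" "l \<le> card C"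
  obtains A where "A \<subseteq> C" "card A = l" "\<And>x y. x \<in> A \<Longrightarrow> y \<in> C - A \<Longrightarrow> w y \<le> w x"
  using assms(2)
proof (induction l arbitrary: thesis)
  case 0
  then show ?case by (metis card.empty empty_iff empty_subsetI)
next
  case (Suc l)
  obtain A where A: "A \<subseteq> C" "card A = l" "\<And>x y. x \<in> A \<Longrightarrow> y \<in> C - A \<Longrightarrow> w y \<le> w x"
    using Suc.IH Suc.prems by (metis Suc_leD)
  have fin: "finite (C - A)" using assms by simp
  have "C - A \<noteq> {}" using A Suc.prems by (metis Diff_eq_empty_iff assms(1) card_mono finite_subset not_less_eq_eq)
  then have "Max (w ` (C - A)) \<in> w ` (C - A)" using fin by (intro Max_in) auto
  then obtain z where z: "z \<in> C - A" "Max (w ` (C - A)) = w z" by blast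
  have z': "w y \<le> w z" if "y \<in> C - A" for y
    using fin that unfolding z(2) [symmetric] by (intro Max_ge) auto
  show ?case
  proof (rule Suc.prems(1)[of "insert z A"])
    show "card (insert z A) = Suc l" using z A finite_subset[OF A(1) assms(1)] by simp
  qed (use z z' A in auto)
qed

text \<open>The weighted sum is largest when \<open>f\<close> equals \<mu> on the \<open>l\<close>
  points where \<open>w\<close> is largest and the remaining mass
  \<open>1 - \<mu> * l = \<theta> / Suc l\<close> sits on the next one. That profile is the mixture,
  with weights \<open>1 - \<theta>\<close> and \<theta>, of the uniform laws on the top
  \<open>l\<close> and the top \<open>Suc l\<close> points.\<close>

lemma bathtub:
  fixes f w :: "int \<Rightarrow> real"
  assumes C: "finite C" and f: "\<And>x. 0 \<le> f x" "\<And>x. f x \<le> \<mu>" "sum f C \<le> 1" and w: "\<And>x. 0 \<le> w x"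
    and l: "l \<ge> 1" and \<theta>: "0 \<le> \<theta>" "\<theta> \<le> 1" and \<mu>: "\<mu> = (1 - \<theta>) / real l + \<theta> / real (Suc l)"
    and K: "\<And>A. finite A \<Longrightarrow> card A = l \<Longrightarrow> sum w A \<le> K"
    and K': "\<And>A. finite A \<Longrightarrow> card A = Suc l \<Longrightarrow> sum w A \<le> K'"
  shows "(\<Sum>x\<in>C. f x * w x) \<le> (1 - \<theta>) * (K / real l) + \<theta> * (K' / real (Suc l))"
proof -
  \<comment> \<open>\<open>C\<close> may have fewer than \<open>Suc l\<close> points; the padding
    guarantees a top set of that size.\<close>
  define D where "D = {1..int (Suc l)} \<union> C"
  have D: "finite D" "Suc l \<le> card D" 
    using C card_mono[of D "{1..int (Suc l)}"] by (auto simp: D_def)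
  obtain A where A: "A \<subseteq> D" "card A = Suc l" "\<And>x y. x \<in> A \<Longrightarrow> y \<in> D - A \<Longrightarrow> w y \<le> w x"
    using obtain_top_subset[OF D, of w] by blast
  have finA: "finite A" using A D finite_subset by blast
  have "A \<noteq> {}" using A by auto
  then have "Min (w ` A) \<in> w ` A" using finA by (intro Min_in) auto
  then obtain z where z: "z \<in> A" "Min (w ` A) = w z" by blast
  have z': "w z \<le> w y" if "y \<in> A" for y
    using finA that unfolding z(2) [symmetric] by (intro Min_le) auto
  \<comment> \<open>The threshold \<open>c\<close> is the \<open>Suc l\<close>-th largest value of
    \<open>w\<close> on \<open>D\<close>. After subtracting it from \<open>w\<close>, points outside
    \<open>A'\<close> contribute at most 0, and on \<open>A'\<close> the bound
    \<open>f \<le> \<mu>\<close> can be used; the subtraction itself costs at most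
    \<open>c\<close>.\<close>
  define A' c where "A' = A - {z}" and "c = w z"
  have A': "A = insert z A'" "z \<notin> A'" "finite A'" "card A' = l" using A z finA by (auto simp: A'_def)
  have le0: "w x - c \<le> 0" if "x \<in> D - A'" for x
    using that A z z' by (auto simp: A'_def c_def)
  have ge0: "w x - c \<ge> 0" if "x \<in> A'" for x
    using that A z z' by (auto simp: A'_def c_def)
  have "(\<Sum>x\<in>C. f x * w x) = (\<Sum>x\<in>C. f x * (w x - c)) + c * sum f C"
    by (simp add: algebra_simps sum.distrib sum_subtractf sum_distrib_left)
  also have "\<dots> \<le> (\<Sum>x\<in>C \<inter> A'. f x * (w x - c)) + c * 1"
  proof (rule add_mono)
    have "(\<Sum>x\<in>C. f x * (w x - c)) = (\<Sum>x\<in>C \<inter> A'. f x * (w x - c)) + (\<Sum>x\<in>C - A'. f x * (w x - c))"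
      using C by (metis (no_types, lifting) add.commute sum.Int_Diff)
    also have "(\<Sum>x\<in>C - A'. f x * (w x - c)) \<le> 0"
      using le0 f by (intro sum_nonpos mult_nonneg_nonpos) (auto simp: D_def)
    finally show "(\<Sum>x\<in>C. f x * (w x - c)) \<le> (\<Sum>x\<in>C \<inter> A'. f x * (w x - c))" by simp
    show "c * sum f C \<le> c * 1" using f(3) w[of z] unfolding c_def by (rule mult_left_mono)
  qed
  also have "(\<Sum>x\<in>C \<inter> A'. f x * (w x - c)) \<le> (\<Sum>x\<in>A'. f x * (w x - c))"
    using A' ge0 f by (intro sum_mono2) auto
  also have "\<dots> \<le> (\<Sum>x\<in>A'. \<mu> * (w x - c))"
    using ge0 f by (intro sum_mono mult_right_mono) auto
  also have "(\<Sum>x\<in>A'. \<mu> * (w x - c)) + c * 1 = \<mu> * sum w A' + (1 - \<mu> * l) * c"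
    using A' by (simp add: sum_subtractf sum_distrib_left [symmetric] algebra_simps)
  also have "\<dots> = (1 - \<theta>) * (sum w A' / l) + \<theta> * (sum w A / real (Suc l))"
    using A' l unfolding \<mu> c_def by (simp add: divide_simps) (simp add: algebra_simps)
  also have "\<dots> \<le> (1 - \<theta>) * (K / real l) + \<theta> * (K' / real (Suc l))"
    using K[of A'] K'[of A] A' A finA \<theta> by (intro add_mono mult_left_mono divide_right_mono) auto
  finally show ?thesis by simp
qed

section \<open>Log-concavity along parity classes\<close>

text \<open>The four-point form avoids division and, for nonnegative \<open>p\<close>, excludes gaps
  in the support within a parity class.\<close>

definition parity_lc :: "(int \<Rightarrow> real) \<Rightarrow> bool" where
  "parity_lc p \<longleftrightarrow> (\<forall>a b c d. a \<le> b \<longrightarrow> a \<le> c \<longrightarrow> a + d = b + c \<longrightarrow> even (b - a) \<longrightarrow> even (c - a)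
     \<longrightarrow> p a * p d \<le> p b * p c)"

lemma parity_lcD:
  "parity_lc p \<Longrightarrow> a \<le> b \<Longrightarrow> a \<le> c \<Longrightarrow> a + d = b + c \<Longrightarrow> even (b - a) \<Longrightarrow> even (c - a)
     \<Longrightarrow> p a * p d \<le> p b * p c"
  unfolding parity_lc_def by blast

text \<open>A shift by any even amount is an iteration of shifts by 2, and the two inner points
  \<open>b\<close> and \<open>c\<close> play symmetric roles, so \<open>b \<le> c\<close> may be
  assumed.\<close>

lemma parity_lcI_step:
  assumes step: "\<And>a c. a \<le> c \<Longrightarrow> even (c - a) \<Longrightarrow> p a * p (c + 2) \<le> p (a + 2) * p c"
  shows "parity_lc p"
proof -
  have *: "p a * p (c + 2 * int s) \<le> p (a + 2 * int s) * p c"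
    if "a + 2 * int s \<le> c" "even (c - a)" for a c s
    using that
  proof (induction s arbitrary: a c)
    case (Suc s)
    have "p a * p (c + 2 * int s + 2) \<le> p (a + 2) * p (c + 2 * int s)"
      using Suc.prems by (intro step) auto
    also have "\<dots> \<le> p (a + 2 + 2 * int s) * p c"
      using Suc.prems by (intro Suc.IH) auto
    finally show ?case by (simp add: algebra_simps)
  qed simp
  have **: "p a * p d \<le> p b * p c"
    if "a \<le> b" "b \<le> c" "a + d = b + c" "even (b - a)" "even (c - a)" for a b c d
  proof -
    define s where "s = nat ((b - a) div 2)"
    have "b = a + 2 * int s" "d = c + 2 * int s" using that by (auto simp: s_def)
    then show ?thesis using *[of a s c] that by simp
  qed
  show ?thesis unfolding parity_lc_def
  proof (intro allI impI)
    fix a b c d :: int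
    assume "a \<le> b" "a \<le> c" "a + d = b + c" "even (b - a)" "even (c - a)"
    then show "p a * p d \<le> p b * p c"
      using **[of a b c d] **[of a c b d] by (cases "b \<le> c") (auto simp: mult.commute)
  qed
qed

text \<open>The averaging windows at \<open>a\<close> and \<open>a + 2\<close> share all but one
  point each: \<open>b\<close> is the top of the upper window, \<open>b - 2 * int l\<close> the
  bottom of the lower one, and \<open>A\<close> the sum over the common part. With \<open>d\<close>
  and \<open>B\<close> likewise for \<open>c\<close>, the product \<open>A * B\<close> cancels and
  the other three pairs of terms compare by log-concavity of \<open>p\<close>.\<close>

lemma parity_lc_smooth:
  assumes p: "parity_lc p" and l: "l \<ge> 1"
  shows "parity_lc (smooth l p)"
proof (rule parity_lcI_step)
  fix a c :: int assume ac: "a \<le> c" "even (c - a)"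
  define b d where "b = a + int l + 1" and "d = c + int l + 1"
  define A B where "A = (\<Sum>j\<in>{1..<l}. p (b - 2 * int j))" and "B = (\<Sum>j\<in>{1..<l}. p (d - 2 * int j))"
  have hi: "(\<Sum>j<l. p (x + 2 + int l - 1 - 2 * int j)) = p (x + int l + 1) + (\<Sum>j\<in>{1..<l}. p (x + int l + 1 - 2 * int j))" for x
  proof -
    have "{..<l} = insert 0 {1..<l}" using l by auto
    then show ?thesis by (simp add: algebra_simps)
  qed
  have lo: "(\<Sum>j<l. p (x + int l - 1 - 2 * int j)) = p (x + int l + 1 - 2 * int l) + (\<Sum>j\<in>{1..<l}. p (x + int l + 1 - 2 * int j))" for x
  proof -
    have "(\<Sum>j<l. p (x + int l - 1 - 2 * int j)) = (\<Sum>j\<in>{0..<l}. p (x + int l + 1 - 2 * int (Suc j)))"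
      by (simp add: algebra_simps atLeast0LessThan)
    also have "\<dots> = (\<Sum>j\<in>{1..<Suc l}. p (x + int l + 1 - 2 * int j))"
      by (rule sum.reindex_bij_witness [where i = "\<lambda>j. j - 1" and j = Suc]) auto
    also have "{1..<Suc l} = insert l {1..<l}" using l by auto
    finally show ?thesis by simp
  qed
  have 1: "A * p (d - 2 * int l) \<ge> B * p (b - 2 * int l)"
    unfolding A_def B_def sum_distrib_right
    by (rule sum_mono, subst mult.commute, rule parity_lcD [OF p]) (use ac in \<open>auto simp: b_def d_def\<close>)
  have 2: "p b * B \<ge> A * p d"
    unfolding A_def B_def sum_distrib_right sum_distrib_left
    by (rule sum_mono, rule parity_lcD [OF p]) (use ac in \<open>auto simp: b_def d_def\<close>)
  have 3: "p b * p (d - 2 * int l) \<ge> p (b - 2 * int l) * p d"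
    by (rule parity_lcD [OF p]) (use ac in \<open>auto simp: b_def d_def\<close>)
  have "(p (b - 2 * int l) + A) * (p d + B) \<le> (p b + A) * (p (d - 2 * int l) + B)"
    using 1 2 3 by (simp add: algebra_simps)
  then show "smooth l p a * smooth l p (c + 2) \<le> smooth l p (a + 2) * smooth l p c"
    unfolding smooth_def hi lo A_def B_def b_def d_def by (simp add: divide_right_mono)
qed

section \<open>Moments of the parity classes under averaging\<close>

lemma sum_offsets: "(\<Sum>j<l. real l - 1 - 2 * real j) = 0"
  and sum_offsets_squared: "(\<Sum>j<l. (real l - 1 - 2 * real j)\<^sup>2) = real l * ((real l)\<^sup>2 - 1) / 3"
proof -
  have 1: "(\<Sum>j<n. real j) = real n * (real n - 1) / 2" for n
    by (induction n) (auto simp: field_simps)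
  have 2: "(\<Sum>j<n. (real j)\<^sup>2) = real n * (real n - 1) * (2 * real n - 1) / 6" for n
    by (induction n) (auto simp: field_simps power2_eq_square)
  show "(\<Sum>j<l. real l - 1 - 2 * real j) = 0"
    by (simp add: sum_subtractf sum_distrib_left [symmetric] 1)
  have "(\<Sum>j<l. (real l - 1 - 2 * real j)\<^sup>2) =
    (\<Sum>j<l. (real l - 1)\<^sup>2 - 4 * (real l - 1) * real j + 4 * (real j)\<^sup>2)"
    by (intro sum.cong refl) (simp add: power2_eq_square algebra_simps)
  also have "\<dots> = real l * (real l - 1)\<^sup>2 - 4 * (real l - 1) * (\<Sum>j<l. real j) + 4 * (\<Sum>j<l. (real j)\<^sup>2)"
    by (simp add: sum.distrib sum_subtractf sum_distrib_left)
  also have "\<dots> = real l * ((real l)\<^sup>2 - 1) / 3"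
    unfolding 1 2 by (simp add: field_simps power2_eq_square)
  finally show "(\<Sum>j<l. (real l - 1 - 2 * real j)\<^sup>2) = real l * ((real l)\<^sup>2 - 1) / 3" .
qed

text \<open>Both parity classes have to be tracked, because \<open>smooth l\<close> swaps them when \<open>l\<close> is even.\<close>

definition moments :: "(int \<Rightarrow> real) \<Rightarrow> real \<Rightarrow> bool" where
  "moments p s \<longleftrightarrow> (\<forall>e. (p has_sum 1) {k. even (k + e)} \<and>
     (\<exists>u. ((\<lambda>k. real_of_int k * p k) has_sum u) {k. even (k + e)}) \<and>
     (\<exists>v\<ge>s. ((\<lambda>k. (real_of_int k)\<^sup>2 * p k) has_sum v) {k. even (k + e)}))"

lemma has_sum_parity_shift:
  fixes f :: "int \<Rightarrow> real"
  assumes "(f has_sum v) {k. even (k + (e - c))}"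
  shows "((\<lambda>k. f (k + c)) has_sum v) {k. even (k + e)}"
  using assms
  by (subst has_sum_reindex_bij_witness[where S = "{k. even (k + e)}" and T = "{k. even (k + (e - c))}"
       and i = "\<lambda>k. k - c" and j = "\<lambda>k. k + c" and h = f]) auto

lemma has_sum_sum_finite:
  fixes f :: "'i \<Rightarrow> 'b \<Rightarrow> real"
  assumes "finite I" "\<And>i. i \<in> I \<Longrightarrow> (f i has_sum v i) A"
  shows "((\<lambda>x. \<Sum>i\<in>I. f i x) has_sum (\<Sum>i\<in>I. v i)) A"
  using assms by (induction I rule: finite_induct) (auto intro!: has_sum_add)

text \<open>Each offset is moved from \<open>p\<close> to the weight \<phi>; the weights 1,
  \<open>k\<close> and the square of \<open>k\<close> then give the three moments of the averaged
  function.\<close>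

lemma has_sum_smooth:
  fixes \<phi> :: "int \<Rightarrow> real"
  assumes "\<And>j. j < l \<Longrightarrow> ((\<lambda>k. \<phi> (k - (int l - 1 - 2 * int j)) * p k) has_sum v j)
     {k. even (k + (e - (int l - 1 - 2 * int j)))}"
  shows "((\<lambda>k. \<phi> k * smooth l p k) has_sum (\<Sum>j<l. v j) / real l) {k. even (k + e)}"
proof -
  have "((\<lambda>k. \<phi> k * p (k + (int l - 1 - 2 * int j))) has_sum v j) {k. even (k + e)}" if "j < l" for j
    using has_sum_parity_shift[OF assms[OF that]] by simp
  then have "((\<lambda>k. \<Sum>j<l. \<phi> k * p (k + (int l - 1 - 2 * int j))) has_sum (\<Sum>j<l. v j)) {k. even (k + e)}"
    by (intro has_sum_sum_finite) auto
  then have "((\<lambda>k. (\<Sum>j<l. \<phi> k * p (k + (int l - 1 - 2 * int j))) * (1 / real l)) has_sum (\<Sum>j<l. v j) * (1 / real l)) {k. even (k + e)}"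
    by (rule has_sum_cmult_left)
  then show ?thesis by (simp add: smooth_def sum_distrib_left sum_divide_distrib algebra_simps)
qed

text \<open>The offsets have mean 0 and mean square \<open>excess l / 3\<close>, so the second
  moment grows by exactly that amount; the cross term with the first moment \<open>u\<close> cancels
  in the average.\<close>

lemma moments_smooth:
  assumes p: "moments p s" and l: "l \<ge> 1"
  shows "moments (smooth l p) (s + ((real l)\<^sup>2 - 1) / 3)"
  unfolding moments_def
proof (intro allI conjI)
  fix e :: int
  define e' where "e' = e - (int l - 1)"
  \<comment> \<open>Offsets differ from each other by even numbers, so all of them shift to the same
    parity class.\<close>
  have cls: "{k. even (k + (e - (int l - 1 - 2 * int j)))} = {k. even (k + e')}" for j
    by (auto simp: e'_def)
  obtain u v where m0: "(p has_sum 1) {k. even (k + e')}"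
    and m1: "((\<lambda>k. real_of_int k * p k) has_sum u) {k. even (k + e')}"
    and m2: "((\<lambda>k. (real_of_int k)\<^sup>2 * p k) has_sum v) {k. even (k + e')}" and v: "v \<ge> s"
    using p unfolding moments_def by blast
  show "(smooth l p has_sum 1) {k. even (k + e)}"
    using has_sum_smooth[of l "\<lambda>_. 1" p e "\<lambda>_. 1", unfolded cls] m0 l by simp
  have "((\<lambda>k. real_of_int (k - (int l - 1 - 2 * int j)) * p k) has_sum
      u - (real l - 1 - 2 * real j) * 1) {k. even (k + e')}" for j
    using has_sum_add[OF m1 has_sum_cmult_right[OF m0, of "- (real l - 1 - 2 * real j)"]]
    by (simp add: algebra_simps)
  from has_sum_smooth[of l real_of_int p e, unfolded cls, OF this]
  show "\<exists>u. ((\<lambda>k. real_of_int k * smooth l p k) has_sum u) {k. even (k + e)}" by blast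
  define t where "t j = real l - 1 - 2 * real j" for j
  have "((\<lambda>k. (real_of_int (k - (int l - 1 - 2 * int j)))\<^sup>2 * p k) has_sum
      v + (- 2 * t j) * u + (t j)\<^sup>2 * 1) {k. even (k + e')}" for j
    using has_sum_add[OF has_sum_add[OF m2 has_sum_cmult_right[OF m1, of "- 2 * t j"]]
        has_sum_cmult_right[OF m0, of "(t j)\<^sup>2"]]
    by (rule has_sum_cong [THEN iffD1, rotated]) (simp add: t_def power2_eq_square algebra_simps)
  from has_sum_smooth[of l "\<lambda>k. (real_of_int k)\<^sup>2" p e, unfolded cls, OF this]
  have "((\<lambda>k. (real_of_int k)\<^sup>2 * smooth l p k) has_sum (\<Sum>j<l. v + (- 2 * t j) * u + (t j)\<^sup>2 * 1) / real l)
    {k. even (k + e)}" .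
  moreover have "(\<Sum>j<l. v + (- 2 * t j) * u + (t j)\<^sup>2 * 1) = real l * v + real l * ((real l)\<^sup>2 - 1) / 3"
  proof -
    have "(\<Sum>j<l. t j) = 0" "(\<Sum>j<l. (t j)\<^sup>2) = real l * ((real l)\<^sup>2 - 1) / 3"
      unfolding t_def by (rule sum_offsets sum_offsets_squared)+
    then show ?thesis
      by (simp add: sum.distrib sum_subtractf sum_distrib_right [symmetric] sum_distrib_left [symmetric])
  qed
  ultimately show "\<exists>v\<ge>s + ((real l)\<^sup>2 - 1) / 3. ((\<lambda>k. (real_of_int k)\<^sup>2 * smooth l p k) has_sum v) {k. even (k + e)}"
    using v l by (intro exI[of _ "v + ((real l)\<^sup>2 - 1) / 3"]) (simp add: add_divide_distrib)
qed


section \<open>Tail decay and the second moment of a log-concave sequence\<close>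

text \<open>\<open>\<psi> k\<close> below is the mean of $(k+G)^2$ for a geometric variable $G$ with ratio $(1-M)/(1+M)$,
  the extremal tail.\<close>

lemma second_moment_le_of_tail_decay:
  fixes x :: "nat \<Rightarrow> real"
  assumes M: "0 < M" "M \<le> 1"
    and tail0: "R 0 = (1 + M) / 2" and R: "\<And>k. R (Suc k) = R k - x k" "\<And>k. 0 \<le> R k"
    and decay: "\<And>k. (1 + M) * R (Suc k) \<le> (1 - M) * R k"
  shows "(\<Sum>k<n. (real k)\<^sup>2 * x k) \<le> (1 / M\<^sup>2 - 1) / 4"
proof -
  define \<psi> where "\<psi> k = (real k)\<^sup>2 + real k * (1 - M) / M + (1 - M) / (2 * M\<^sup>2)" for k
  have \<psi>: "\<psi> k \<ge> 0" for k
    unfolding \<psi>_def using M by (intro add_nonneg_nonneg divide_nonneg_nonneg mult_nonneg_nonneg) auto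
  have ge: "\<psi> (Suc k) - (real k)\<^sup>2 \<ge> 0" for k
  proof -
    have "\<psi> (Suc k) - (real k)\<^sup>2 = 2 * real k + 1 + real (Suc k) * (1 - M) / M + (1 - M) / (2 * M\<^sup>2)"
      by (simp add: \<psi>_def power2_eq_square algebra_simps)
    also have "\<dots> \<ge> 0"
      using M by (intro add_nonneg_nonneg divide_nonneg_nonneg mult_nonneg_nonneg) auto
    finally show ?thesis .
  qed
  \<comment> \<open>First-step conditioning for the geometric variable: \<open>\<psi> k\<close>
    averages the square of \<open>k\<close>, with weight \<open>2 * M / (1 + M)\<close>, and
    \<open>\<psi> (Suc k)\<close>, with weight \<open>(1 - M) / (1 + M)\<close>.\<close>
  have eq: "(1 + M) * (\<psi> k - (real k)\<^sup>2) = (1 - M) * (\<psi> (Suc k) - (real k)\<^sup>2)" for k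
    using M unfolding \<psi>_def by (simp add: field_simps) (simp add: power2_eq_square algebra_simps)
  \<comment> \<open>By \<open>eq\<close>, the decay of \<open>R\<close> turns each term of the
    second moment into part of a telescoping sum.\<close>
  have step: "(real k)\<^sup>2 * x k \<le> \<psi> k * R k - \<psi> (Suc k) * R (Suc k)" for k
  proof -
    have "(1 + M) * ((\<psi> (Suc k) - (real k)\<^sup>2) * R (Suc k)) = (\<psi> (Suc k) - (real k)\<^sup>2) * ((1 + M) * R (Suc k))"
      by simp
    also have "\<dots> \<le> (\<psi> (Suc k) - (real k)\<^sup>2) * ((1 - M) * R k)"
      by (rule mult_left_mono [OF decay ge])
    also have "\<dots> = ((1 + M) * (\<psi> k - (real k)\<^sup>2)) * R k" unfolding eq by simp
    also have "\<dots> = (1 + M) * ((\<psi> k - (real k)\<^sup>2) * R k)" by simp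
    finally have "(\<psi> (Suc k) - (real k)\<^sup>2) * R (Suc k) \<le> (\<psi> k - (real k)\<^sup>2) * R k"
      using M by simp
    moreover have xk: "x k = R k - R (Suc k)" using R(1) by simp
    ultimately show ?thesis unfolding xk by (simp add: algebra_simps)
  qed
  have "(\<Sum>k<n. (real k)\<^sup>2 * x k) \<le> \<psi> 0 * R 0 - \<psi> n * R n"
    using step by (induction n) (auto, smt (verit, best))
  also have "\<dots> \<le> \<psi> 0 * R 0" using \<psi>[of n] R(2)[of n] by simp
  also have "\<dots> = (1 / M\<^sup>2 - 1) / 4"
    using M by (simp add: tail0 \<psi>_def field_simps power2_eq_square)
  finally show ?thesis .
qed

text \<open>Summing \<open>lc\<close> over \<open>j\<close> shows that the tail beyond
  \<open>k\<close>, relative to \<open>x k\<close>, is at most its value at \<open>k = 0\<close>.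
  There \<open>total\<close> gives \<open>R 1 = (1 - x 0) / 2\<close>, and writing
  \<open>x k\<close> as \<open>R k - R (Suc k)\<close> turns this into geometric decay.\<close>

lemma logconcave_tail_decay:
  fixes x :: "nat \<Rightarrow> real"
  assumes x: "summable x" and lc: "\<And>j k. x 0 * x (Suc k + j) \<le> x (Suc j) * x k"
    and total: "suminf x = (1 + x 0) / 2"
  defines "R \<equiv> \<lambda>k. suminf x - sum x {..<k}"
  shows "(1 + x 0) * R (Suc k) \<le> (1 - x 0) * R k"
proof -
  have R: "R k = (\<Sum>j. x (j + k))" for k
    unfolding R_def by (rule suminf_minus_initial_segment [symmetric, OF x])
  have "x 0 * R (Suc k) = (\<Sum>j. x 0 * x (j + Suc k))"
    unfolding R by (rule suminf_mult [symmetric]) (use x in \<open>simp only: summable_iff_shift\<close>)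
  also have "\<dots> \<le> (\<Sum>j. x (j + 1) * x k)"
  proof (rule suminf_le)
    show "summable (\<lambda>j. x 0 * x (j + Suc k))" "summable (\<lambda>j. x (j + 1) * x k)"
      using x by (intro summable_mult summable_mult2; simp only: summable_iff_shift)+
  qed (use lc[of k] in \<open>simp add: add.commute\<close>)
  also have "\<dots> = R 1 * x k"
    unfolding R by (rule suminf_mult2 [symmetric]) (use x in \<open>simp only: summable_iff_shift\<close>)
  finally have *: "x 0 * R (Suc k) \<le> R 1 * x k" .
  have R1: "R 1 = (1 - x 0) / 2" using total by (simp add: R_def field_simps)
  have xk: "x k = R k - R (Suc k)" by (simp add: R_def)
  have "2 * (x 0 * R (Suc k)) \<le> (1 - x 0) * (R k - R (Suc k))"
    using * unfolding R1 xk by simp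
  then show ?thesis by (simp add: algebra_simps)
qed

text \<open>Folding at 0 pairs the positive even points with their mirror images and keeps the whole
  of the centre, hence the extra \<open>p 0\<close>.\<close>

lemma has_sum_even_symmetric:
  fixes p :: "int \<Rightarrow> real"
  assumes sym: "\<And>k. p (- k) = p k" and p: "(p has_sum v) {k. even k}"
  shows "(\<lambda>k. p (2 * int k)) sums ((v + p 0) / 2)"
proof -
  define P where "P = {k::int. even k \<and> k > 0}"
  have P: "p summable_on P"
    using summable_on_subset_banach[of p "{k. even k}" P] p by (auto simp: P_def summable_on_def)
  define u where "u = infsum p P"
  have u: "(p has_sum u) P" using P by (simp add: u_def)
  have u': "(p has_sum u) (uminus ` P)"
    using u by (subst has_sum_reindex) (auto simp: o_def sym)
  have "(p has_sum (u + u)) (P \<union> uminus ` P)"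
    by (rule has_sum_Un_disjoint [OF u u']) (auto simp: P_def)
  then have "(p has_sum (p 0 + (u + u))) (insert 0 (P \<union> uminus ` P))"
    by (intro has_sum_insert) (auto simp: P_def)
  also have "insert 0 (P \<union> uminus ` P) = {k. even k}"
    by (auto simp: P_def image_iff) (smt (verit) even_minus)
  finally have v: "v = p 0 + 2 * u" using p has_sum_unique by fastforce
  have "(p has_sum (p 0 + u)) (insert 0 P)" using u by (intro has_sum_insert) (auto simp: P_def)
  also have "insert 0 P = range (\<lambda>k. 2 * int k)"
    by (auto simp: P_def image_iff elim!: evenE) (metis nonneg_int_cases not_less_iff_gr_or_eq order_le_less zero_less_mult_pos zero_less_numeral)
  finally have "((\<lambda>k. p (2 * int k)) has_sum (p 0 + u)) UNIV"
    by (subst (asm) has_sum_reindex) (auto simp: inj_on_def o_def)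
  then have "(\<lambda>k. p (2 * int k)) sums (p 0 + u)" by (rule has_sum_imp_sums)
  moreover have "p 0 + u = (v + p 0) / 2" using v by simp
  ultimately show ?thesis by simp
qed

section \<open>The central mass of an averaged sign function\<close>

text \<open>The starting function: the empty sum is constantly 0, and the largest probability that
  it lies in an \<open>m\<close>-element set is 1 for positive \<open>m\<close> and 0 for
  \<open>m = 0\<close>; this is extended to an odd function.\<close>

abbreviation sgnr :: "int \<Rightarrow> real" where "sgnr m \<equiv> real_of_int (sgn m)"

text \<open>For positive \<open>l\<close>, twelve times the variance of the uniform law on
  \<open>l\<close> consecutive integers.\<close>

abbreviation excess :: "nat \<Rightarrow> real" where "excess l \<equiv> (real l)\<^sup>2 - 1"

lemma excess_nonneg: "l \<ge> 1 \<Longrightarrow> 0 \<le> excess l"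
  by (simp add: self_le_power)

text \<open>Half a unit of mass at $\pm 1$ makes each parity class carry total mass 1, so that the even
  class is centred at an integer whatever the parity of the offsets added later.\<close>

definition bump :: "int \<Rightarrow> real" where "bump k = (sgnr (k + 1) - sgnr (k - 1)) / 2"

lemma bump_eq: "bump k = (if k = 0 then 1 else if k = 1 \<or> k = -1 then 1 / 2 else 0)"
  by (auto simp: bump_def sgn_if)

lemma bump_nonneg: "0 \<le> bump k"
  by (simp add: bump_eq)

lemma parity_lc_bump: "parity_lc bump"
  unfolding parity_lc_def
proof (intro allI impI)
  fix a b c d :: int
  assume h: "a \<le> b" "a \<le> c" "a + d = b + c" "even (b - a)" "even (c - a)"
  show "bump a * bump d \<le> bump b * bump c"
  proof (cases "bump a * bump d = 0")
    case False
    then have "\<bar>a\<bar> \<le> 1" "\<bar>d\<bar> \<le> 1" by (auto simp: bump_eq split: if_splits)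
    then have "(b = a \<and> c = d) \<or> (b = d \<and> c = a)" using h by presburger
    then show ?thesis by auto
  next
    case True
    then show ?thesis by (metis bump_nonneg mult_nonneg_nonneg)
  qed
qed

lemma moments_bump: "moments bump 0"
  unfolding moments_def
proof (intro allI)
  fix e :: int
  define E where "E = (if even e then {0::int} else {-1, 1})"
  have *: "((\<lambda>k. \<phi> k * bump k) has_sum (\<Sum>k\<in>E. \<phi> k * bump k)) {k. even (k + e)}" for \<phi>
  proof -
    have "((\<lambda>k. \<phi> k * bump k) has_sum (\<Sum>k\<in>E. \<phi> k * bump k)) E"
      by (rule has_sum_finite) (simp add: E_def)
    also have "?this \<longleftrightarrow> ?thesis"
      by (rule has_sum_cong_neutral) (auto simp: E_def bump_eq split: if_splits)
    finally show ?thesis .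
  qed
  show "(bump has_sum 1) {k. even (k + e)} \<and>
     (\<exists>u. ((\<lambda>k. real_of_int k * bump k) has_sum u) {k. even (k + e)}) \<and>
     (\<exists>v\<ge>0. ((\<lambda>k. (real_of_int k)\<^sup>2 * bump k) has_sum v) {k. even (k + e)})"
  proof (intro conjI)
    show "(bump has_sum 1) {k. even (k + e)}"
    proof -
      have "(\<Sum>k\<in>E. 1 * bump k) = 1" by (simp add: E_def bump_eq)
      then show ?thesis using *[of "\<lambda>_. 1"] by simp
    qed
    show "\<exists>u. ((\<lambda>k. real_of_int k * bump k) has_sum u) {k. even (k + e)}"
      using * by blast
    show "\<exists>v\<ge>0. ((\<lambda>k. (real_of_int k)\<^sup>2 * bump k) has_sum v) {k. even (k + e)}"
      using *[of "\<lambda>k. (real_of_int k)\<^sup>2"]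
      by (intro exI[of _ "\<Sum>k\<in>E. (real_of_int k)\<^sup>2 * bump k"] conjI sum_nonneg) (auto simp: bump_eq)
  qed
qed

lemma foldr_smooth_uminus:
  assumes "\<And>m. F (- m) = - F m"
  shows "foldr smooth L F (- m) = - foldr smooth L F m"
  by (induction L arbitrary: m) (use assms in \<open>auto intro: smooth_uminus\<close>)

text \<open>Averaging is linear and commutes with shifts. At \<open>k = 0\<close> oddness makes the
  right side equal to \<open>foldr smooth L sgnr 1\<close>, so that number is a central
  mass.\<close>

lemma foldr_smooth_bump:
  "foldr smooth L bump = (\<lambda>k. (foldr smooth L sgnr (k + 1) - foldr smooth L sgnr (k - 1)) / 2)"
proof (induction L)
  case Nil
  show ?case by (simp add: fun_eq_iff bump_def)
next
  case (Cons l L)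
  define F where "F = foldr smooth L sgnr"
  have "foldr smooth (l # L) bump = smooth l (\<lambda>k. (1 / 2) * F (k + 1) + (- 1 / 2) * F (k + - 1))"
    using Cons.IH by (simp add: F_def diff_divide_distrib)
  also have "\<dots> = (\<lambda>k. (1 / 2) * smooth l F (k + 1) + (- 1 / 2) * smooth l F (k + - 1))"
    unfolding smooth_linear smooth_shift ..
  finally show ?case by (simp add: F_def diff_divide_distrib)
qed

text \<open>The even class of \<open>p\<close> has mass 1 and second moment at least
  \<open>s / 3\<close>. Halving its points gives a symmetric log-concave law on the integers with
  variance at least \<open>s / 12\<close>, and the bound on the central mass follows from the
  second-moment estimate.\<close>

lemma foldr_smooth_sgn_le:
  assumes L: "\<And>l. l \<in> set L \<Longrightarrow> l \<ge> 1"
  shows "foldr smooth L sgnr 1 \<le> sqrt (6 / (6 + sum_list (map excess L)))"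
proof -
  define p where "p = foldr smooth L bump"
  define s where "s = sum_list (map excess L)"
  have s: "s \<ge> 0" unfolding s_def using L by (intro sum_list_nonneg) (auto intro: excess_nonneg)
  have odd: "foldr smooth L sgnr (- m) = - foldr smooth L sgnr m" for m
    by (rule foldr_smooth_uminus) simp
  have p0: "p 0 = foldr smooth L sgnr 1"
    using odd[of 1] by (simp add: p_def foldr_smooth_bump)
  have sym: "p (- k) = p k" for k
    using odd[of "k + 1"] odd[of "k - 1"] by (simp add: p_def foldr_smooth_bump)
  have "parity_lc p \<and> moments p (s / 3) \<and> (\<forall>k. 0 \<le> p k)"
    unfolding p_def s_def using L
  proof (induction L)
    case Nil
    show ?case using parity_lc_bump moments_bump bump_nonneg by simp
  next
    case (Cons l L)
    then have "moments (smooth l (foldr smooth L bump)) (sum_list (map excess L) / 3 + excess l / 3)"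
      by (intro moments_smooth) auto
    moreover have "parity_lc (smooth l (foldr smooth L bump))" using Cons by (intro parity_lc_smooth) auto
    moreover have "0 \<le> smooth l (foldr smooth L bump) k" for k
      using Cons unfolding smooth_def by (intro divide_nonneg_nonneg sum_nonneg) auto
    ultimately show ?case by (simp add: add_divide_distrib add.commute)
  qed
  then have lc: "parity_lc p" and nonneg: "\<And>k. 0 \<le> p k" and mom: "moments p (s / 3)" by blast+
  obtain v where m0: "(p has_sum 1) {k. even k}" and v: "v \<ge> s / 3"
    and m2: "((\<lambda>k. (real_of_int k)\<^sup>2 * p k) has_sum v) {k. even k}"
    using mom [unfolded moments_def, THEN spec, of 0] by auto
  define x where "x k = p (2 * int k)" for k
  have x0: "x 0 = p 0" by (simp add: x_def)
  have sums: "x sums ((1 + x 0) / 2)"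
    using has_sum_even_symmetric[OF sym m0] unfolding x_def by simp
  \<comment> \<open>A factor 1/4 comes from halving the points and 1/2 from folding at 0, where the
    second-moment summand vanishes.\<close>
  have sums2: "(\<lambda>k. (real k)\<^sup>2 * x k) sums (v / 8)"
  proof -
    have "(\<lambda>k. 4 * ((real k)\<^sup>2 * x k)) sums (v / 2)"
      using has_sum_even_symmetric[OF _ m2] sym by (simp add: x_def power_mult_distrib mult.assoc)
    from sums_divide[OF this, of 4] show ?thesis by simp
  qed
  have total: "suminf x = (1 + x 0) / 2" and summable: "summable x"
    using sums by (auto simp: sums_iff)
  show ?thesis
  proof (cases "p 0 = 0")
    case True
    then show ?thesis using s p0 by (simp add: s_def)
  next
    case False
    then have pos: "x 0 > 0" using nonneg[of 0] x0 by simp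
    define R where "R k = suminf x - sum x {..<k}" for k
    have Rn: "R k \<ge> 0" for k
      unfolding R_def using sum_le_suminf[OF summable, of "{..<k}"] nonneg by (simp add: x_def)
    have "x 0 \<le> 1" using Rn[of 1] total by (simp add: R_def)
    have "(\<Sum>k<n. (real k)\<^sup>2 * x k) \<le> (1 / (x 0)\<^sup>2 - 1) / 4" for n
    proof (rule second_moment_le_of_tail_decay [where R = R])
      have "x 0 * x (Suc k + j) \<le> x (Suc j) * x k" for j k
        unfolding x_def by (rule parity_lcD [OF lc]) auto
      from logconcave_tail_decay[OF summable this total]
      show "(1 + x 0) * R (Suc k) \<le> (1 - x 0) * R k" for k
        unfolding R_def .
      show "R 0 = (1 + x 0) / 2" "R (Suc k) = R k - x k" for k
        using total by (simp_all add: R_def)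
    qed (fact pos \<open>x 0 \<le> 1\<close> Rn)+
    then have "v / 8 \<le> (1 / (x 0)\<^sup>2 - 1) / 4"
      using sums2 by (intro LIMSEQ_le_const2[of "\<lambda>n. \<Sum>k<n. (real k)\<^sup>2 * x k"]) (auto simp: sums_def)
    then have "(6 + s) / 6 \<le> 1 / (x 0)\<^sup>2" using v by simp
    then have "(x 0)\<^sup>2 \<le> 6 / (6 + s)" using pos s by (simp add: field_simps)
    then show ?thesis unfolding p0 [symmetric] x0 [symmetric] s_def by (rule real_le_rsqrt)
  qed
qed

section \<open>Mixtures of two adjacent lengths\<close>

text \<open>A pair \<open>(l, \<theta>)\<close> encodes the law that is uniform on \<open>l\<close>
  points with weight \<open>1 - \<theta>\<close> and on \<open>Suc l\<close> points with weight
  \<theta>.\<close>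

definition mix :: "nat \<times> real \<Rightarrow> (int \<Rightarrow> real) \<Rightarrow> int \<Rightarrow> real" where
  "mix q F m = (1 - snd q) * smooth (fst q) F m + snd q * smooth (Suc (fst q)) F m"

text \<open>For \<open>l \<ge> 1\<close>, the largest mass of the encoded law when the
  \<open>l\<close> points lie among the \<open>Suc l\<close> points.\<close>

definition peak :: "nat \<times> real \<Rightarrow> real" where
  "peak q = (1 - snd q) / real (fst q) + snd q / real (Suc (fst q))"

lemma peak_bounds:
  assumes l: "l \<ge> 1" and \<theta>: "0 \<le> \<theta>" "\<theta> \<le> 1"
  shows "1 / real (Suc l) \<le> peak (l, \<theta>)" "0 < peak (l, \<theta>)" "1 \<le> 1 / (peak (l, \<theta>))\<^sup>2"
proof -
  have "(1 - \<theta>) * (1 / real (Suc l)) + \<theta> * (1 / real (Suc l)) \<le> (1 - \<theta>) * (1 / real l) + \<theta> * (1 / real (Suc l))"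
    using l \<theta> by (intro add_mono mult_left_mono) (auto simp: field_simps)
  then show ge: "1 / real (Suc l) \<le> peak (l, \<theta>)" by (simp add: peak_def diff_divide_distrib)
  have "(1 - \<theta>) * (1 / real l) + \<theta> * (1 / real (Suc l)) \<le> (1 - \<theta>) * 1 + \<theta> * 1"
    using l \<theta> by (intro add_mono mult_left_mono) (auto simp: field_simps)
  then have le: "peak (l, \<theta>) \<le> 1" by (simp add: peak_def)
  have "0 < 1 / real (Suc l)" by simp
  then show pos: "0 < peak (l, \<theta>)" using ge by linarith
  have "(peak (l, \<theta>))\<^sup>2 \<le> 1" using le pos by (simp add: power_le_one)
  then show "1 \<le> 1 / (peak (l, \<theta>))\<^sup>2" using pos by simp
qed

text \<open>The constant is \<open>3 / 11 = 6 / 22\<close>, which becomes 1/22 in the end. For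
  \<open>l \<ge> 2\<close> already \<open>excess l\<close> is large enough, so the longer length is
  bounded by the shorter one. For \<open>l = 1\<close> that excess is 0 and the gain has to come
  from \<theta>.\<close>

lemma mix_step:
  assumes c: "c \<ge> 6" and l: "l \<ge> 1" and \<theta>: "0 \<le> \<theta>" "\<theta> \<le> 1"
  shows "(1 - \<theta>) * (6 / (c + excess l)) + \<theta> * (6 / (c + excess (Suc l)))
    \<le> 6 / (c + 3 / 11 * (1 / (peak (l, \<theta>))\<^sup>2 - 1))"
proof -
  define d where "d = 3 / 11 * (1 / (peak (l, \<theta>))\<^sup>2 - 1)"
  note peak = peak_bounds[OF l \<theta>]
  have d0: "d \<ge> 0" using peak(3) by (simp add: d_def)
  show ?thesis
  proof (cases "l = 1")
    case True
    have pk: "peak (l, \<theta>) = (2 - \<theta>) / 2" using True by (simp add: peak_def field_simps)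
    have "4 - (2 - \<theta>)\<^sup>2 = \<theta> * (4 - \<theta>)" by (simp add: power2_eq_square algebra_simps)
    moreover have "1 / ((2 - \<theta>) / 2)\<^sup>2 - 1 = (4 - (2 - \<theta>)\<^sup>2) / (2 - \<theta>)\<^sup>2"
      unfolding power_divide using \<theta> by (simp add: diff_divide_distrib)
    ultimately have "1 / ((2 - \<theta>) / 2)\<^sup>2 - 1 = \<theta> * (4 - \<theta>) / (2 - \<theta>)\<^sup>2"
      by simp
    also have "\<dots> \<le> 3 * \<theta>"
    proof -
      have "(4 - \<theta>) \<le> 3 * (2 - \<theta>)\<^sup>2"
      proof -
        have "0 \<le> (1 - \<theta>) * (8 - 3 * \<theta>)" using \<theta> by (intro mult_nonneg_nonneg) auto
        then show ?thesis by (simp add: power2_eq_square algebra_simps)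
      qed
      from mult_left_mono[OF this \<theta>(1)] have "\<theta> * (4 - \<theta>) \<le> 3 * \<theta> * (2 - \<theta>)\<^sup>2"
        by (simp only: mult_ac)
      moreover have "0 < (2 - \<theta>)\<^sup>2" using \<theta> by simp
      ultimately show ?thesis by (subst pos_divide_le_eq)
    qed
    finally have d: "d \<le> 2 * \<theta>" using \<theta> unfolding d_def pk by simp
    have "(1 - \<theta>) * (6 / (c + excess l)) + \<theta> * (6 / (c + excess (Suc l))) = (6 * (c + 3 - 3 * \<theta>)) / (c * (c + 3))"
      using True c by (simp add: field_simps)
    \<comment> \<open>Comparing first-order terms in \<theta> at \<open>c = 6\<close> shows that 2
      is the largest possible coefficient here.\<close>
    also have "\<dots> \<le> 6 / (c + 2 * \<theta>)"
    proof -
      have "(c + 3 - 3 * \<theta>) * (c + 2 * \<theta>) = c * (c + 3) - \<theta> * (c - 6 + 6 * \<theta>)"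
        by (simp add: algebra_simps)
      also have "\<dots> \<le> c * (c + 3)" using \<theta> c by simp
      finally have "6 * ((c + 3 - 3 * \<theta>) * (c + 2 * \<theta>)) \<le> 6 * (c * (c + 3))"
        by (rule mult_left_mono) simp
      then have "6 * (c + 3 - 3 * \<theta>) * (c + 2 * \<theta>) \<le> 6 * (c * (c + 3))"
        by (simp only: mult.assoc)
      moreover have "0 < c * (c + 3)" "0 < c + 2 * \<theta>" using c \<theta> by auto
      ultimately show ?thesis by (simp only: pos_divide_le_eq times_divide_eq_left pos_le_divide_eq)
    qed
    also have "\<dots> \<le> 6 / (c + d)" using d d0 c by (intro frac_le) linarith+
    finally show ?thesis unfolding d_def .
  next
    case False
    then have l2: "real l \<ge> 2" using l by simp
    have "1 / (peak (l, \<theta>))\<^sup>2 \<le> 1 / (1 / real (Suc l))\<^sup>2"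
      using peak by (intro divide_left_mono power_mono) auto
    then have "d \<le> 3 / 11 * excess (Suc l)" by (simp add: d_def power_divide)
    also have "\<dots> \<le> excess l"
    proof -
      \<comment> \<open>The right side is \<open>11 * excess l - 3 * excess (Suc l)\<close>,
        expanded around \<open>l = 2\<close>.\<close>
      have "0 \<le> (real l - 2) * (8 * real l + 10) + 9" using l2 by simp
      then show ?thesis by (simp add: power2_eq_square algebra_simps)
    qed
    finally have d: "d \<le> excess l" .
    have "excess l \<le> excess (Suc l)" by (simp add: power_mono)
    then have "6 / (c + excess (Suc l)) \<le> 6 / (c + excess l)"
      using c d d0 by (intro frac_le) linarith+
    then have "(1 - \<theta>) * (6 / (c + excess l)) + \<theta> * (6 / (c + excess (Suc l))) \<le> (1 - \<theta>) * (6 / (c + excess l)) + \<theta> * (6 / (c + excess l))"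
      using \<theta> by (intro add_mono mult_left_mono order_refl) auto
    also have "\<dots> = 6 / (c + excess l)" by (simp only: distrib_right [symmetric]) simp
    also have "\<dots> \<le> 6 / (c + d)" using d d0 c by (intro frac_le) linarith+
    finally show ?thesis unfolding d_def .
  qed
qed

lemma foldr_smooth_linear:
  "foldr smooth L (\<lambda>m. a * F m + b * G m) = (\<lambda>m. a * foldr smooth L F m + b * foldr smooth L G m)"
  by (induction L) (auto simp: smooth_linear)

lemma sqrt_concave:
  assumes "0 \<le> \<theta>" "\<theta> \<le> 1" "0 \<le> a" "0 \<le> b"
  shows "(1 - \<theta>) * sqrt a + \<theta> * sqrt b \<le> sqrt ((1 - \<theta>) * a + \<theta> * b)"
proof (rule real_le_rsqrt)
  have "(1 - \<theta>) * (sqrt a)\<^sup>2 + \<theta> * (sqrt b)\<^sup>2 - ((1 - \<theta>) * sqrt a + \<theta> * sqrt b)\<^sup>2 = \<theta> * (1 - \<theta>) * (sqrt a - sqrt b)\<^sup>2"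
    by (simp add: power2_eq_square algebra_simps)
  also have "\<dots> \<ge> 0" using assms by simp
  finally show "((1 - \<theta>) * sqrt a + \<theta> * sqrt b)\<^sup>2 \<le> (1 - \<theta>) * a + \<theta> * b" using assms by simp
qed

text \<open>\<open>L\<close> collects the lengths already chosen. The head of \<open>P\<close>
  splits into its two lengths, each is appended to \<open>L\<close> for the induction hypothesis,
  and concavity of the square root with \<open>mix_step\<close> merges the two bounds.\<close>

lemma foldr_mix_sgn_le:
  assumes P: "\<And>q. q \<in> set P \<Longrightarrow> fst q \<ge> 1 \<and> 0 \<le> snd q \<and> snd q \<le> 1"
    and L: "\<And>l. l \<in> set L \<Longrightarrow> l \<ge> 1"
  shows "foldr smooth L (foldr mix P sgnr) 1
    \<le> sqrt (6 / (6 + sum_list (map excess L) + 3 / 11 * (\<Sum>q\<leftarrow>P. 1 / (peak q)\<^sup>2 - 1)))"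
  using P L
proof (induction P arbitrary: L)
  case Nil
  then show ?case using foldr_smooth_sgn_le[of L] by simp
next
  case (Cons q P)
  obtain l \<theta> where q: "q = (l, \<theta>)" by (cases q)
  have l: "l \<ge> 1" and \<theta>: "0 \<le> \<theta>" "\<theta> \<le> 1" using Cons.prems(1)[of q] q by auto
  define G where "G = foldr mix P sgnr"
  define c where "c = 6 + sum_list (map excess L) + 3 / 11 * (\<Sum>q\<leftarrow>P. 1 / (peak q)\<^sup>2 - 1)"
  have "0 \<le> sum_list (map excess L)"
    using Cons.prems(2) by (intro sum_list_nonneg) (auto intro: excess_nonneg)
  moreover have "0 \<le> (\<Sum>q\<leftarrow>P. 1 / (peak q)\<^sup>2 - 1)"
  proof (intro sum_list_nonneg)
    fix y assume "y \<in> set (map (\<lambda>q. 1 / (peak q)\<^sup>2 - 1) P)"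
    then obtain l' \<theta>' where "(l', \<theta>') \<in> set P" "y = 1 / (peak (l', \<theta>'))\<^sup>2 - 1" by auto
    then show "0 \<le> y" using peak_bounds(3)[of l' \<theta>'] Cons.prems(1)[of "(l', \<theta>')"] by simp
  qed
  ultimately have c: "c \<ge> 6" by (simp add: c_def)
  have step: "foldr smooth L (smooth k G) 1 \<le> sqrt (6 / (c + excess k))" if "k \<ge> 1" for k
  proof -
    have "foldr smooth (L @ [k]) G 1
      \<le> sqrt (6 / (6 + sum_list (map excess (L @ [k])) + 3 / 11 * (\<Sum>q\<leftarrow>P. 1 / (peak q)\<^sup>2 - 1)))"
      unfolding G_def by (rule Cons.IH) (use Cons.prems that in auto)
    also have "6 + sum_list (map excess (L @ [k])) + 3 / 11 * (\<Sum>q\<leftarrow>P. 1 / (peak q)\<^sup>2 - 1) = c + excess k"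
      by (simp add: c_def)
    finally show ?thesis by simp
  qed
  have ex: "0 \<le> excess l" "0 \<le> excess (Suc l)" using l by (intro excess_nonneg; simp)+
  have "foldr smooth L (foldr mix (q # P) sgnr) 1 =
      (1 - \<theta>) * foldr smooth L (smooth l G) 1 + \<theta> * foldr smooth L (smooth (Suc l) G) 1"
    by (simp add: G_def q mix_def [abs_def] foldr_smooth_linear)
  also have "\<dots> \<le> (1 - \<theta>) * sqrt (6 / (c + excess l)) + \<theta> * sqrt (6 / (c + excess (Suc l)))"
    using l \<theta> by (intro add_mono mult_left_mono step) auto
  also have "\<dots> \<le> sqrt ((1 - \<theta>) * (6 / (c + excess l)) + \<theta> * (6 / (c + excess (Suc l))))"
    using \<theta> c ex by (intro sqrt_concave divide_nonneg_nonneg) auto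
  also have "\<dots> \<le> sqrt (6 / (c + 3 / 11 * (1 / (peak (l, \<theta>))\<^sup>2 - 1)))"
    by (intro real_sqrt_le_mono mix_step c l \<theta>)
  also have "c + 3 / 11 * (1 / (peak (l, \<theta>))\<^sup>2 - 1) =
      6 + sum_list (map excess L) + 3 / 11 * (\<Sum>q\<leftarrow>q # P. 1 / (peak q)\<^sup>2 - 1)"
    unfolding c_def q by simp
  finally show ?case .
qed

lemma foldr_mix_uminus:
  assumes "\<And>m. F (- m) = - F m"
  shows "foldr mix P F (- m) = - foldr mix P F m"
  using assms by (induction P arbitrary: m) (auto simp: mix_def smooth_uminus)

lemma exists_peak:
  assumes "0 < \<mu>" "\<mu> \<le> 1"
  shows "\<exists>q. fst q \<ge> 1 \<and> 0 \<le> snd q \<and> snd q \<le> 1 \<and> peak q = \<mu>"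
proof -
  define l where "l = nat \<lfloor>1 / \<mu>\<rfloor>"
  \<comment> \<open>Solves \<open>peak (l, \<theta>) = \<mu>\<close>: the mass
    \<open>1 - real l * \<mu>\<close> left over by \<open>l\<close> points of mass \<mu> is
    \<open>\<theta> / Suc l\<close>.\<close>
  define \<theta> where "\<theta> = real (Suc l) * (1 - real l * \<mu>)"
  have "1 \<le> 1 / \<mu>" using assms by simp
  then have "1 \<le> \<lfloor>1 / \<mu>\<rfloor>" by (simp add: le_floor_iff)
  then have fl: "real l = of_int \<lfloor>1 / \<mu>\<rfloor>" and l: "l \<ge> 1" unfolding l_def by linarith+
  have "real l \<le> 1 / \<mu>" "1 / \<mu> < real l + 1" unfolding fl by linarith+
  then have lo: "real l * \<mu> \<le> 1" and hi: "1 \<le> real (Suc l) * \<mu>"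
    using assms by (simp_all add: field_simps)
  have "\<theta> \<ge> 0" using lo by (simp add: \<theta>_def)
  moreover have "\<theta> \<le> 1"
    using mult_left_mono[OF hi, of "real l"] by (simp add: \<theta>_def algebra_simps)
  moreover have "peak (l, \<theta>) = \<mu>"
  proof -
    have "\<theta> / real (Suc l) = 1 - real l * \<mu>" unfolding \<theta>_def by (simp del: of_nat_Suc)
    moreover have "1 - \<theta> = real l * (real (Suc l) * \<mu> - 1)" by (simp add: \<theta>_def algebra_simps)
    then have "(1 - \<theta>) / real l = real (Suc l) * \<mu> - 1" using l by simp
    ultimately show ?thesis by (simp add: peak_def algebra_simps)
  qed
  ultimately show ?thesis using l by (intro exI[of _ "(l, \<theta>)"]) auto
qed

section \<open>Adding one independent variable\<close>

lemma measurable_sum_int [measurable (raw)]: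
  fixes f :: "'i \<Rightarrow> 'b \<Rightarrow> int"
  assumes "\<And>i. i \<in> I \<Longrightarrow> f i \<in> measurable N (count_space UNIV)"
  shows "(\<lambda>x. \<Sum>i\<in>I. f i x) \<in> measurable N (count_space UNIV)"
  using assms
proof (induction I rule: infinite_finite_induct)
  case (insert i I)
  then have [measurable]: "f i \<in> measurable N (count_space UNIV)"
    "(\<lambda>x. \<Sum>i\<in>I. f i x) \<in> measurable N (count_space UNIV)" by auto
  have "(\<lambda>x. f i x + (\<Sum>i\<in>I. f i x)) \<in> measurable N (count_space UNIV)"
    by measurable
  then show ?case using insert.hyps by simp
qed simp_all

context prob_space
begin

lemma sum_prob_mass:
  assumes X: "random_variable (count_space UNIV) X" and "finite C"
  shows "sum (prob_mass M X) C = prob {\<omega> \<in> space M. X \<omega> \<in> C}"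
proof -
  have "prob (\<Union>k\<in>C. {\<omega> \<in> space M. X \<omega> = k}) = (\<Sum>k\<in>C. prob {\<omega> \<in> space M. X \<omega> = k})"
  proof (rule finite_measure_finite_Union)
    show "(\<lambda>k. {\<omega> \<in> space M. X \<omega> = k}) ` C \<subseteq> events"
      using X by (intro image_subsetI) measurable
  qed (use \<open>finite C\<close> in \<open>auto simp: disjoint_family_on_def\<close>)
  also have "(\<Union>k\<in>C. {\<omega> \<in> space M. X \<omega> = k}) = {\<omega> \<in> space M. X \<omega> \<in> C}" by auto
  finally show ?thesis by (simp add: prob_mass_def)
qed

text \<open>Allows finite windows to replace sums over all integers, up to an error tending to
  0.\<close>

lemma tight_int:
  fixes X :: "'a \<Rightarrow> int"
  assumes X: "random_variable (count_space UNIV) X"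
  shows "(\<lambda>n. prob {\<omega> \<in> space M. X \<omega> \<in> {- int n..int n}}) \<longlonglongrightarrow> 1"
proof -
  have "(\<lambda>n. prob {\<omega> \<in> space M. X \<omega> \<in> {- int n..int n}}) \<longlonglongrightarrow> prob (\<Union>n. {\<omega> \<in> space M. X \<omega> \<in> {- int n..int n}})"
    using X by (intro finite_Lim_measure_incseq) (auto simp: incseq_def)
  also have "(\<Union>n. {\<omega> \<in> space M. X \<omega> \<in> {- int n..int n}}) = space M"
  proof (intro subset_antisym subsetI)
    fix \<omega> assume "\<omega> \<in> space M"
    then show "\<omega> \<in> (\<Union>n. {\<omega> \<in> space M. X \<omega> \<in> {- int n..int n}})"
      by (intro UN_I[of "nat \<bar>X \<omega>\<bar>"]) auto
  qed auto
  finally show ?thesis by (simp add: prob_space)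
qed

text \<open>Conditioning on \<open>X = x\<close> leaves the weight \<open>w x\<close>, the
  probability that \<open>Y\<close> lies in \<open>B\<close> shifted by \<open>- x\<close>. The hook
  bound controls sums of \<open>w\<close> over \<open>l\<close>-element sets by \<open>K l\<close>,
  \<open>bathtub\<close> passes from the law of \<open>X\<close> to the mixture \<open>q\<close>,
  and \<open>smooth_hooks\<close> identifies \<open>K l / l\<close> with \<open>smooth l F\<close>
  at \<open>card B\<close>.\<close>

lemma prob_sum_le_mix:
  fixes X Y :: "'a \<Rightarrow> int"
  assumes indep: "indep_var (count_space UNIV) Y (count_space UNIV) X"
    and F: "\<And>C. finite C \<Longrightarrow> prob {\<omega> \<in> space M. Y \<omega> \<in> C} \<le> F (int (card C))"
    and odd: "\<And>m. F (- m) = - F m"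
    and q: "fst q \<ge> 1" "0 \<le> snd q" "snd q \<le> 1" and peak: "\<And>k. prob_mass M X k \<le> peak q"
    and B: "finite B"
  shows "prob {\<omega> \<in> space M. Y \<omega> + X \<omega> \<in> B} \<le> mix q F (int (card B))"
proof -
  obtain l \<theta> where ql: "q = (l, \<theta>)" by (cases q)
  note rv [measurable] = indep_var_rv1[OF indep] indep_var_rv2[OF indep]
  define m where "m = card B"
  define w where "w x = (\<Sum>b\<in>B. prob_mass M Y (b - x))" for x
  have w: "w x = prob {\<omega> \<in> space M. Y \<omega> \<in> (\<lambda>b. b - x) ` B}" for x
    unfolding sum_prob_mass[OF rv(1) finite_imageI[OF B], symmetric]
    by (simp add: w_def sum.reindex inj_on_def)
  have prod: "prob {\<omega> \<in> space M. X \<omega> = x \<and> Y \<omega> + X \<omega> \<in> B} = prob_mass M X x * w x" for x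
  proof -
    have "{\<omega> \<in> space M. X \<omega> = x \<and> Y \<omega> + X \<omega> \<in> B} = (\<lambda>\<omega>. (Y \<omega>, X \<omega>)) -` (((\<lambda>b. b - x) ` B) \<times> {x}) \<inter> space M"
      by (auto simp: image_iff) (metis add_diff_cancel_right')
    also have "prob \<dots> = prob (Y -` ((\<lambda>b. b - x) ` B) \<inter> space M) * prob (X -` {x} \<inter> space M)"
      by (rule indep_varD[OF indep]) auto
    also have "\<dots> = prob_mass M X x * w x"
      unfolding w prob_mass_def by (simp add: vimage_def Int_def conj_commute)
    finally show ?thesis .
  qed
  define K where "K l = (\<Sum>t<min l m. F (int (l + m - 1 - 2 * t)))" for l
  have K: "sum w A \<le> K l" if "finite A" "card A = l" for A l
    unfolding w_def K_def using that B F
    by (intro sum_differences_le_hooks) (auto simp: m_def sum_prob_mass[OF rv(1)])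
  have bound: "(\<Sum>x\<in>C. prob_mass M X x * w x) \<le> mix q F (int m)" if C: "finite C" for C
  proof -
    have "(\<Sum>x\<in>C. prob_mass M X x * w x) \<le> (1 - \<theta>) * (K l / real l) + \<theta> * (K (Suc l) / real (Suc l))"
    proof (rule bathtub [OF C, where \<mu> = "peak q"])
      show "sum (prob_mass M X) C \<le> 1" unfolding sum_prob_mass[OF rv(2) C] by simp
    qed (use q peak ql K in \<open>auto simp: prob_mass_def w peak_def\<close>)
    then show ?thesis by (simp add: ql mix_def K_def smooth_hooks[where F = F, OF odd] del: of_nat_Suc)
  qed
  \<comment> \<open>\<open>X\<close> is truncated to a finite window; the event outside it is
    bounded by its whole probability, which vanishes as \<open>n\<close> grows.\<close>
  have "prob {\<omega> \<in> space M. Y \<omega> + X \<omega> \<in> B} \<le> mix q F (int m) + (1 - prob {\<omega> \<in> space M. X \<omega> \<in> {- int n..int n}})" for n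
  proof -
    let ?C = "{- int n..int n}"
    have [measurable]: "(\<lambda>\<omega>. Y \<omega> + X \<omega>) \<in> measurable M (count_space UNIV)" by measurable
    have ev: "{\<omega> \<in> space M. X \<omega> = x \<and> Y \<omega> + X \<omega> \<in> B} \<in> events" for x by measurable
    have ev': "(\<Union>x\<in>?C. {\<omega> \<in> space M. X \<omega> = x \<and> Y \<omega> + X \<omega> \<in> B}) \<in> events"
      using ev by (intro sets.finite_UN) auto
    have evC: "{\<omega> \<in> space M. X \<omega> \<in> ?C} \<in> events"
      using measurable_sets[OF rv(2), of ?C] by (simp add: vimage_def Int_def conj_commute)
    have "prob {\<omega> \<in> space M. Y \<omega> + X \<omega> \<in> B} \<le>
      prob ((\<Union>x\<in>?C. {\<omega> \<in> space M. X \<omega> = x \<and> Y \<omega> + X \<omega> \<in> B}) \<union> (space M - {\<omega> \<in> space M. X \<omega> \<in> ?C}))"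
      using ev' evC by (intro finite_measure_mono) auto
    also have "\<dots> \<le> prob (\<Union>x\<in>?C. {\<omega> \<in> space M. X \<omega> = x \<and> Y \<omega> + X \<omega> \<in> B}) + prob (space M - {\<omega> \<in> space M. X \<omega> \<in> ?C})"
      using ev' evC by (intro measure_Un_le) auto
    also have "prob (\<Union>x\<in>?C. {\<omega> \<in> space M. X \<omega> = x \<and> Y \<omega> + X \<omega> \<in> B}) \<le> (\<Sum>x\<in>?C. prob_mass M X x * w x)"
      unfolding prod [symmetric] using ev by (intro finite_measure_subadditive_finite) auto
    also have "\<dots> \<le> mix q F (int m)" by (rule bound) simp
    also have "prob (space M - {\<omega> \<in> space M. X \<omega> \<in> ?C}) = 1 - prob {\<omega> \<in> space M. X \<omega> \<in> ?C}"
      using evC by (rule prob_compl)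
    finally show ?thesis by simp
  qed
  moreover have "(\<lambda>n. mix q F (int m) + (1 - prob {\<omega> \<in> space M. X \<omega> \<in> {- int n..int n}})) \<longlonglongrightarrow> mix q F (int m) + (1 - 1)"
    by (intro tendsto_intros tight_int rv)
  ultimately show ?thesis unfolding m_def [symmetric]
    using LIMSEQ_le_const by fastforce
qed

lemma indep_var_sum_count_space:
  fixes X :: "'i \<Rightarrow> 'a \<Rightarrow> int"
  assumes I: "finite I" "i \<notin> I" and indep: "indep_vars (\<lambda>_. count_space UNIV) X (insert i I)"
  shows "indep_var (count_space UNIV) (\<lambda>\<omega>. \<Sum>j\<in>I. X j \<omega>) (count_space UNIV) (X i)"
proof -
  have "indep_var
    (count_space UNIV) ((\<lambda>f. \<Sum>j\<in>I. f j) \<circ> (\<lambda>\<omega>. restrict (\<lambda>j. X j \<omega>) I))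
    (count_space UNIV) ((\<lambda>f. f i) \<circ> (\<lambda>\<omega>. restrict (\<lambda>j. X j \<omega>) {i}))"
    using I by (intro indep_var_compose[OF indep_var_restrict[OF indep]]) auto
  also have "((\<lambda>f. f i) \<circ> (\<lambda>\<omega>. restrict (\<lambda>j. X j \<omega>) {i})) = X i" by auto
  also have "((\<lambda>f. \<Sum>j\<in>I. f j) \<circ> (\<lambda>\<omega>. restrict (\<lambda>j. X j \<omega>) I)) = (\<lambda>\<omega>. \<Sum>j\<in>I. X j \<omega>)"
    by (auto cong: rev_conj_cong)
  finally show ?thesis .
qed

section \<open>Largest masses and the final inequality\<close>

lemma mass_sup_bounds:
  assumes X: "random_variable (count_space UNIV) X"
  shows prob_mass_le_mass_sup: "prob_mass M X k \<le> mass_sup M X"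
    and mass_sup_pos: "0 < mass_sup M X" and mass_sup_le_1: "mass_sup M X \<le> 1"
proof -
  have bdd: "bdd_above (range (prob_mass M X))"
    by (rule bdd_aboveI[of _ 1]) (auto simp: prob_mass_def)
  then show le: "prob_mass M X k \<le> mass_sup M X" for k
    unfolding mass_sup_def by (intro cSUP_upper) auto
  show "mass_sup M X \<le> 1" unfolding mass_sup_def by (intro cSUP_least) (auto simp: prob_mass_def)
  show "0 < mass_sup M X"
  proof (rule ccontr)
    assume "\<not> 0 < mass_sup M X"
    then have "prob_mass M X k = 0" for k
      using le[of k] by (simp add: prob_mass_def order_antisym)
    then have "prob {\<omega> \<in> space M. X \<omega> \<in> {- int n..int n}} = 0" for n
      using sum_prob_mass[OF X, of "{- int n..int n}"] by simp
    then show False using tight_int[OF X] LIMSEQ_unique[OF tendsto_const] by fastforce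
  qed
qed

lemma Delta_inf_eq:
  assumes "random_variable (count_space UNIV) X"
  shows "Delta_inf M X = 1 / (mass_sup M X)\<^sup>2 - 1"
proof -
  have "exp (2 * min_entropy M X) = 1 / (exp (ln (mass_sup M X)))\<^sup>2"
    by (simp add: min_entropy_def exp_minus power2_eq_square mult_exp_exp [symmetric] exp_double field_simps)
  then show ?thesis using mass_sup_pos[OF assms] by (simp add: Delta_inf_def)
qed

lemma Delta_inf_sum_ge:
  fixes X :: "nat \<Rightarrow> 'a \<Rightarrow> int"
  assumes indep: "indep_vars (\<lambda>_. count_space UNIV) X {1..n}"
  shows "Delta_inf M (\<lambda>\<omega>. \<Sum>i=1..n. X i \<omega>) \<ge> (1 / 22) * (\<Sum>i=1..n. Delta_inf M (X i))"
proof -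
  define S where "S k = (\<lambda>\<omega>. \<Sum>i=1..k. X i \<omega>)" for k
  have rv [measurable]: "random_variable (count_space UNIV) (X i)" if "i \<in> {1..n}" for i
    using indep that by (auto simp: indep_vars_def)
  have "\<exists>q. fst q \<ge> 1 \<and> 0 \<le> snd q \<and> snd q \<le> 1 \<and> peak q = mass_sup M (X i)" if "i \<in> {1..n}" for i
    using exists_peak mass_sup_bounds[OF rv[OF that]] by blast
  then obtain q where q: "\<And>i. i \<in> {1..n} \<Longrightarrow> fst (q i) \<ge> 1 \<and> 0 \<le> snd (q i) \<and> snd (q i) \<le> 1 \<and> peak (q i) = mass_sup M (X i)"
    by metis
  \<comment> \<open>The reversal puts the newest variable at the head, where \<open>foldr\<close>
    applies it outermost.\<close>
  define P where "P k = map q (rev [1..<Suc k])" for k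
  have conc: "prob {\<omega> \<in> space M. S k \<omega> \<in> B} \<le> foldr mix (P k) sgnr (int (card B))"
    if "k \<le> n" "finite B" for k B
    using that
  proof (induction k arbitrary: B)
    case 0
    show ?case
    proof (cases "B = {}")
      case False
      then have "sgn (int (card B)) = 1" using 0 by (simp add: card_gt_0_iff)
      then show ?thesis by (simp add: P_def)
    qed (simp add: P_def)
  next
    case (Suc k)
    have eq: "S (Suc k) = (\<lambda>\<omega>. S k \<omega> + X (Suc k) \<omega>)" by (simp add: S_def fun_eq_iff)
    have P: "P (Suc k) = q (Suc k) # P k" by (simp add: P_def)
    have "indep_vars (\<lambda>_. count_space UNIV) X (insert (Suc k) {1..k})"
      using Suc.prems by (intro indep_vars_subset[OF indep]) auto
    then have ind: "indep_var (count_space UNIV) (S k) (count_space UNIV) (X (Suc k))"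
      unfolding S_def by (intro indep_var_sum_count_space) auto
    have mem: "Suc k \<in> {1..n}" using Suc.prems by simp
    show ?case unfolding eq P foldr.simps o_def
    proof (rule prob_sum_le_mix[OF ind])
      show "foldr mix (P k) sgnr (- m) = - foldr mix (P k) sgnr m" for m
        by (rule foldr_mix_uminus) simp
      show "prob_mass M (X (Suc k)) j \<le> peak (q (Suc k))" for j
        using q[OF mem] prob_mass_le_mass_sup[OF rv[OF mem]] by simp
    qed (use Suc q[OF mem] in auto)
  qed
  have meas: "random_variable (count_space UNIV) (S n)"
    unfolding S_def by measurable
  define D where "D = (\<Sum>i=1..n. Delta_inf M (X i))"
  have D: "(\<Sum>q\<leftarrow>P n. 1 / (peak q)\<^sup>2 - 1) = D"
  proof -
    have "(\<Sum>q\<leftarrow>P n. 1 / (peak q)\<^sup>2 - 1) = (\<Sum>i\<leftarrow>[1..<Suc n]. 1 / (peak (q i))\<^sup>2 - 1)"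
      unfolding P_def by (simp only: map_map o_def rev_map [symmetric] sum_list_rev)
    also have "\<dots> = (\<Sum>i\<in>{1..<Suc n}. 1 / (peak (q i))\<^sup>2 - 1)"
      by (subst sum_list_distinct_conv_sum_set) (auto simp del: upt_Suc)
    also have "\<dots> = D" unfolding D_def
      by (intro sum.cong atLeastLessThanSuc_atLeastAtMost) (use q Delta_inf_eq[OF rv] in auto)
    finally show ?thesis .
  qed
  have D0: "D \<ge> 0" unfolding D_def
  proof (rule sum_nonneg)
    fix i assume i: "i \<in> {1..n}"
    then show "0 \<le> Delta_inf M (X i)"
      using mass_sup_pos[OF rv[OF i]] mass_sup_le_1[OF rv[OF i]] by (simp add: Delta_inf_eq[OF rv[OF i]] power_le_one)
  qed
  have "prob_mass M (S n) k \<le> sqrt (6 / (6 + 3 / 11 * D))" for k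
  proof -
    have "prob_mass M (S n) k = prob {\<omega> \<in> space M. S n \<omega> \<in> {k}}" by (simp add: prob_mass_def)
    also have "\<dots> \<le> foldr mix (P n) sgnr 1" using conc[of n "{k}"] by simp
    also have "\<dots> \<le> sqrt (6 / (6 + 3 / 11 * D))"
    proof -
      have "foldr smooth [] (foldr mix (P n) sgnr) 1 \<le> sqrt (6 / (6 + sum_list (map excess []) +
          3 / 11 * (\<Sum>q\<leftarrow>P n. 1 / (peak q)\<^sup>2 - 1)))"
      proof (rule foldr_mix_sgn_le)
        fix p assume "p \<in> set (P n)"
        then obtain i where "i \<in> {1..n}" "p = q i"
          unfolding P_def by (auto simp: less_Suc_eq_le simp del: upt_Suc)
        then show "fst p \<ge> 1 \<and> 0 \<le> snd p \<and> snd p \<le> 1" using q[of i] by blast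
      qed simp
      then show ?thesis unfolding D by simp
    qed
    finally show ?thesis .
  qed
  then have "mass_sup M (S n) \<le> sqrt (6 / (6 + 3 / 11 * D))"
    unfolding mass_sup_def by (intro cSUP_least) auto
  then have "(mass_sup M (S n))\<^sup>2 \<le> (sqrt (6 / (6 + 3 / 11 * D)))\<^sup>2"
    using mass_sup_pos[OF meas] by (intro power_mono) auto
  also have "\<dots> = 6 / (6 + 3 / 11 * D)" using D0 by simp
  finally have bound: "(mass_sup M (S n))\<^sup>2 \<le> 6 / (6 + 3 / 11 * D)" .
  \<comment> \<open>Here \<open>3 / 11\<close> divided by 6 is 1/22.\<close>
  have "1 + D / 22 = 1 / (6 / (6 + 3 / 11 * D))" by simp
  also have "\<dots> \<le> 1 / (mass_sup M (S n))\<^sup>2"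
    using mass_sup_pos[OF meas] bound by (intro frac_le) auto
  finally have "1 + D / 22 \<le> 1 / (mass_sup M (S n))\<^sup>2" .
  then show ?thesis
    using Delta_inf_eq[OF meas] by (simp add: D_def S_def)
qed

end

theorem theorem4p9:
  fixes M :: "'a measure" and X :: "nat \<Rightarrow> 'a \<Rightarrow> int" and n :: nat
  assumes "prob_space M"
    and "n \<ge> 1"
    and "prob_space.indep_vars M (\<lambda>_. count_space UNIV) X {1..n}"
  shows "Delta_inf M (\<lambda>\<omega>. \<Sum>i=1..n. X i \<omega>) \<ge> (1 / 22) * (\<Sum>i=1..n. Delta_inf M (X i))"
  using prob_space.Delta_inf_sum_ge[OF assms(1,3)] .

end
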